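(* Let $k\ge 0$ be an integer and let $\psi:I\to\mathbb{E}^3$ be a curve parameterized by arc length $s$, with curvature $\kappa(s)\neq 0$ and torsion $\tau(s)\neq 0$ for all $s\in I$. Then $\psi$ is a $k$-slant helix if and only if there is a constant $\phi\in(0,\pi)$ such that $\sigma_k(s)=\cot\phi$ for all $s\in I$; here $\phi$ is the constant angle that the unit vector $\psi_{k+1}$ makes with a fixed (suitably oriented) straight line in space.
   Context: $\mathbb{E}^3$ is Euclidean 3-space, $I\subset\mathbb{R}$ is an open interval, and $'$ denotes $d/ds$. The curve is assumed sufficiently differentiable (e.g. of class $C^{k+3}$) for all objects below to exist. Let $\{\mathbf{T},\mathbf{N},\mathbf{B}\}$ be the Frenet frame of $\psi$, so $\mathbf{T}=\psi'$, $\mathbf{T}'=\kappa\mathbf{N}$, $\mathbf{N}'=-\kappa\mathbf{T}+\tau\mathbf{B}$, $\mathbf{B}'=-\tau\mathbf{N}$, with curvature $\kappa>0$. Define $\psi_0=\psi$ and recursively $\psi_{j+1}(s)=\psi_j'(s)/\|\psi_j'(s)\|$ for $j\ge 0$ (so $\psi_1=\mathbf{T}$, $\psi_2=\mathbf{N}$). The curve $\psi$ is called a $k$-slant helix if $\psi_{k+1}$ makes a constant angle with a fixed direction, i.e. there is a constant unit vector $\mathbf{d}$ such that $\langle\psi_{k+1}(s),\mathbf{d}\rangle$ is constant on $I$. Define functions $\sigma_j$ on $I$ by $\sigma_0=\tau/\kappa$ and, for $j\ge 1$, $$\sigma_j=\frac{\sigma_{j-1}'}{\kappa\,\Big(\prod_{i=0}^{j-2}\sqrt{1+\sigma_i^2}\Big)\,(1+\sigma_{j-1}^2)^{3/2}},$$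 where an empty product equals $1$. *)

theory Defs
  imports "HOL-Analysis.Analysis"
begin

text \<open>
  Curves are total functions from the reals to Euclidean 3-space, considered only on an open
  interval \<open>I\<close>. Since \<open>I\<close> is open, two-sided derivatives at points of \<open>I\<close> depend only on the
  restriction to \<open>I\<close>.
\<close>

primrec C_on :: "nat \<Rightarrow> (real \<Rightarrow> 'a::real_normed_vector) \<Rightarrow> real set \<Rightarrow> bool" where
  "C_on 0 f I \<longleftrightarrow> continuous_on I f"
| "C_on (Suc n) f I \<longleftrightarrow>
     (\<forall>s\<in>I. f differentiable (at s)) \<and> C_on n (\<lambda>s. vector_derivative f (at s)) I"

definition unit_speed_on :: "(real \<Rightarrow> real^3) \<Rightarrow> real set \<Rightarrow> bool" where
  "unit_speed_on \<psi> I \<longleftrightarrow> (\<forall>s\<in>I. norm (vector_derivative \<psi> (at s)) = 1)"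

text \<open>The following formulas are those of the Frenet apparatus only for arc length parameterized curves.\<close>

definition tangent :: "(real \<Rightarrow> real^3) \<Rightarrow> real \<Rightarrow> real^3" where
  "tangent \<psi> s = vector_derivative \<psi> (at s)"

definition curvature :: "(real \<Rightarrow> real^3) \<Rightarrow> real \<Rightarrow> real" where
  "curvature \<psi> s = norm (vector_derivative (tangent \<psi>) (at s))"

definition principal_normal :: "(real \<Rightarrow> real^3) \<Rightarrow> real \<Rightarrow> real^3" where
  "principal_normal \<psi> s = vector_derivative (tangent \<psi>) (at s) /\<^sub>R curvature \<psi> s"

definition binormal :: "(real \<Rightarrow> real^3) \<Rightarrow> real \<Rightarrow> real^3" where
  "binormal \<psi> s = cross3 (tangent \<psi> s) (principal_normal \<psi> s)"

text \<open>The sign convention is $\mathbf{N}' = -\kappa\mathbf{T} + \tau\mathbf{B}$.\<close>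

definition torsion :: "(real \<Rightarrow> real^3) \<Rightarrow> real \<Rightarrow> real" where
  "torsion \<psi> s = inner (vector_derivative (principal_normal \<psi>) (at s)) (binormal \<psi> s)"

primrec iter_tangent :: "(real \<Rightarrow> real^3) \<Rightarrow> nat \<Rightarrow> real \<Rightarrow> real^3" where
  "iter_tangent \<psi> 0 = \<psi>"
| "iter_tangent \<psi> (Suc j) =
     (\<lambda>s. vector_derivative (iter_tangent \<psi> j) (at s)
            /\<^sub>R norm (vector_derivative (iter_tangent \<psi> j) (at s)))"

definition slant_axis :: "nat \<Rightarrow> (real \<Rightarrow> real^3) \<Rightarrow> real set \<Rightarrow> real^3 \<Rightarrow> bool" where
  "slant_axis k \<psi> I d \<longleftrightarrow>
     norm d = 1 \<and> (\<exists>c. \<forall>s\<in>I. inner (iter_tangent \<psi> (k + 1) s) d = c)"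

definition slant_helix :: "nat \<Rightarrow> (real \<Rightarrow> real^3) \<Rightarrow> real set \<Rightarrow> bool" where
  "slant_helix k \<psi> I \<longleftrightarrow> (\<exists>d. slant_axis k \<psi> I d)"

text \<open>With $j = m + 1$, the product over $0 \le i \le j - 2$ becomes one over $i < m$.\<close>

fun slant_sigma :: "(real \<Rightarrow> real^3) \<Rightarrow> nat \<Rightarrow> real \<Rightarrow> real" where
  "slant_sigma \<psi> 0 = (\<lambda>s. torsion \<psi> s / curvature \<psi> s)"
| "slant_sigma \<psi> (Suc m) =
     (\<lambda>s. deriv (slant_sigma \<psi> m) s /
            (curvature \<psi> s * (\<Prod>i<m. sqrt (1 + (slant_sigma \<psi> i s)\<^sup>2))
              * (1 + (slant_sigma \<psi> m s)\<^sup>2) powr (3/2)))"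

definition vec_angle :: "real^3 \<Rightarrow> real^3 \<Rightarrow> real" where
  "vec_angle u v = arccos (inner u v / (norm u * norm v))"

end

theory Submission
  imports Defs
begin

text \<open>
  Along the curve there is one orthonormal frame for every \<open>j\<close>: its first two vectors are the iterated
  tangents \<open>T = \<psi>\<^bsub>j+1\<^esub>\<close> and \<open>N = \<psi>\<^bsub>j+2\<^esub>\<close>, its third is \<open>B = T \<times> N\<close>. Because \<open>N\<close> is the
  normalized derivative of \<open>T\<close>, this frame satisfies Frenet equations with a curvature \<open>\<kappa>\<^sub>j > 0\<close>
  and a torsion \<open>\<tau>\<^sub>j\<close>. The theorem is Lancret's theorem on general helices, applied to frame \<open>k\<close>,
  together with the identity \<open>\<sigma>\<^sub>k = \<tau>\<^sub>k / \<kappa>\<^sub>k\<close>.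

  The identity holds for \<open>j = 0\<close> by definition and propagates as follows. Since
  \<open>N' = \<kappa>\<^sub>j (\<sigma>\<^sub>j B - T)\<close>, the next frame consists of \<open>N\<close> and of \<open>-T\<close> and \<open>B\<close> turned
  about \<open>N\<close> by the angle \<open>arctan \<sigma>\<^sub>j\<close>. Its curvature is the length \<open>\<kappa>\<^sub>j sqrt (1 + \<sigma>\<^sub>j\<^sup>2)\<close> of \<open>N'\<close>, and its
  torsion is the angular rate \<open>\<sigma>\<^sub>j' / (1 + \<sigma>\<^sub>j\<^sup>2)\<close>. The ratio of the two is the recursion that
  defines \<open>\<sigma>\<close> (\<open>frenet_on_next\<close>, \<open>iter_tangent_frenet\<close>). In particular no later curvature
  vanishes, so that all iterated tangents are unit vectors.

  For Lancret's theorem, suppose that \<open>T \<bullet> d\<close> is a constant \<open>c\<close> for a fixed unit vector \<open>d\<close>.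
  Differentiating twice gives \<open>N \<bullet> d = 0\<close> and \<open>\<sigma> (B \<bullet> d) = c\<close>, where \<open>b = B \<bullet> d\<close> is constant too and
  \<open>c\<^sup>2 + b\<^sup>2 = 1\<close>. So \<open>b\<close> cannot vanish, and \<open>\<sigma> = c / b\<close>. Conversely, if \<open>\<sigma> = cot \<phi>\<close>, then
  \<open>cos \<phi> T + sin \<phi> B\<close> has derivative zero and is the axis sought
  (\<open>frenet_on_axis_components\<close>, \<open>frenet_on_axis_exists\<close>).

  The derivatives of \<open>\<sigma>\<close> in the recursion must exist. This follows from the smoothness of the
  iterated tangents, which is why classes of continuously differentiable functions are shown to be
  closed under products and normalization.
\<close>

section \<open>Functions with continuous derivatives on an open set\<close>

lemma vector_derivative_cong_open:
  assumes "open I" "s \<in> I" "\<And>t. t \<in> I \<Longrightarrow> f t = g t"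
  shows "vector_derivative f (at s) = vector_derivative g (at s)"
  by (rule vector_derivative_cong_eq)
    (use assms in \<open>auto intro: eventually_mono[OF eventually_nhds_in_open]\<close>)

lemma differentiable_cong_open:
  fixes f g :: "real \<Rightarrow> 'a::real_normed_vector"
  assumes "open I" "s \<in> I" "\<And>t. t \<in> I \<Longrightarrow> f t = g t" "f differentiable (at s)"
  shows "g differentiable (at s)"
  using assms has_vector_derivative_transform_within_open[of f _ s I g]
  by (metis vector_derivative_works differentiableI_vector)

lemma C_on_cong:
  assumes "open I" "\<And>t. t \<in> I \<Longrightarrow> f t = g t" "C_on n f I"
  shows "C_on n g I"
  using assms(2,3)
proof (induction n arbitrary: f g)
  case 0
  then show ?case by (simp cong: continuous_on_cong)
next
  case (Suc n)
  have "C_on n (\<lambda>s. vector_derivative g (at s)) I"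
    by (rule Suc.IH[of "\<lambda>s. vector_derivative f (at s)"])
      (use Suc.prems vector_derivative_cong_open[OF assms(1)] in auto)
  moreover have "\<forall>s\<in>I. g differentiable (at s)"
    using Suc.prems differentiable_cong_open[OF assms(1), of _ f g] by simp
  ultimately show ?case by simp
qed

lemma C_on_SucD:
  assumes "C_on (Suc n) f I"
  shows "C_on n f I"
  using assms
proof (induction n arbitrary: f)
  case 0
  then show ?case
    by (auto intro!: differentiable_imp_continuous_on
        simp: differentiable_on_def differentiable_at_withinI)
next
  case (Suc n)
  then show ?case by (metis C_on.simps(2))
qed

lemma C_on_antimono:
  assumes "m \<le> n" "C_on n f I"
  shows "C_on m f I"
  using assms by (induction rule: dec_induct) (auto dest: C_on_SucD simp del: C_on.simps)

lemma C_on_SucI: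
  assumes "open I" "\<And>s. s \<in> I \<Longrightarrow> (f has_vector_derivative f' s) (at s)" "C_on n f' I"
  shows "C_on (Suc n) f I"
proof -
  have "C_on n (\<lambda>s. vector_derivative f (at s)) I"
    by (rule C_on_cong[OF assms(1) _ assms(3)]) (use assms(2) vector_derivative_at in fastforce)
  then show ?thesis
    using assms(2) differentiableI_vector by auto
qed

lemma C_on_SucE:
  assumes "C_on (Suc n) f I" "s \<in> I"
  shows "(f has_vector_derivative vector_derivative f (at s)) (at s)"
  using assms vector_derivative_works by auto

lemma C_on_vector_derivative: "C_on (Suc n) f I \<Longrightarrow> C_on n (\<lambda>s. vector_derivative f (at s)) I"
  by simp

lemma C_on_add:
  assumes "open I" "C_on n f I" "C_on n g I"
  shows "C_on n (\<lambda>s. f s + g s) I"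
  using assms(2,3)
proof (induction n arbitrary: f g)
  case 0
  then show ?case by (simp add: continuous_on_add)
next
  case (Suc n)
  show ?case
    by (rule C_on_SucI[OF assms(1) has_vector_derivative_add[OF C_on_SucE C_on_SucE]])
      (use Suc C_on_vector_derivative in blast)+
qed

lemma C_on_bilinear:
  assumes "bounded_bilinear p" "open I" "C_on n f I" "C_on n g I"
  shows "C_on n (\<lambda>s. p (f s) (g s)) I"
  using assms(3,4)
proof (induction n arbitrary: f g)
  case 0
  then show ?case by (simp add: bounded_bilinear.continuous_on[OF assms(1)])
next
  case (Suc n)
  show ?case
  proof (rule C_on_SucI[OF assms(2)])
    show "((\<lambda>s. p (f s) (g s)) has_vector_derivative
        p (f s) (vector_derivative g (at s)) + p (vector_derivative f (at s)) (g s)) (at s)"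
      if "s \<in> I" for s
      using that Suc.prems
      by (intro bounded_bilinear.has_vector_derivative[OF assms(1)] C_on_SucE)
    show "C_on n (\<lambda>s. p (f s) (vector_derivative g (at s)) + p (vector_derivative f (at s)) (g s)) I"
      using Suc.prems by (intro C_on_add[OF assms(2)] Suc.IH)
        (blast dest: C_on_SucD C_on_vector_derivative)+
  qed
qed

text \<open>
  The derivative of \<open>1 / norm f\<close> is \<open>- (f \<bullet> f') / (norm f)^3\<close>, a polynomial in \<open>f\<close>, \<open>f'\<close> and the
  function itself. Hence one more derivative of \<open>f\<close> gives one more derivative of \<open>1 / norm f\<close>.
\<close>

lemma C_on_inverse_norm:
  fixes f :: "real \<Rightarrow> 'a::real_inner"
  assumes "open I" "C_on n f I" "\<And>s. s \<in> I \<Longrightarrow> f s \<noteq> 0"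
  shows "C_on n (\<lambda>s. inverse (norm (f s))) I"
  using assms(2,3)
proof (induction n)
  case 0
  then show ?case by (auto intro!: continuous_intros)
next
  case (Suc n)
  let ?h = "\<lambda>s. inverse (norm (f s))"
  let ?f' = "\<lambda>s. vector_derivative f (at s)"
  note mult = C_on_bilinear[OF bounded_bilinear_mult assms(1)]
  show ?case
  proof (rule C_on_SucI[OF assms(1)])
    show "(?h has_vector_derivative (?h s * (?h s * ?h s)) * ((-1) * (f s \<bullet> ?f' s))) (at s)"
      if "s \<in> I" for s
    proof -
      have nz: "f s \<noteq> 0" using Suc.prems(2) that .
      have "(f has_derivative (\<lambda>x. x *\<^sub>R ?f' s)) (at s)"
        using C_on_SucE[OF Suc.prems(1) that] by (simp add: has_vector_derivative_def)
      then have "((\<lambda>s. norm (f s)) has_derivative (\<lambda>x. (x *\<^sub>R ?f' s) \<bullet> sgn (f s))) (at s)"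
        using nz by (rule has_derivative_norm[THEN has_derivative_compose[rotated], rotated -1])
      then have "((\<lambda>s. norm (f s)) has_real_derivative (?f' s \<bullet> sgn (f s))) (at s)"
        by (simp add: has_field_derivative_def mult.commute[of _ "_ \<bullet> _"] mult_commute_abs)
      then have "(?h has_real_derivative
          - (inverse (norm (f s)) * (?f' s \<bullet> sgn (f s)) * inverse (norm (f s)))) (at s)"
        using nz by (intro DERIV_inverse') auto
      then show ?thesis
        by (simp add: has_real_derivative_iff_has_vector_derivative sgn_div_norm
            inner_commute algebra_simps divide_inverse)
    qed
    have h: "C_on n ?h I"
      using Suc C_on_SucD by blast
    have "C_on n (\<lambda>s. f s \<bullet> ?f' s) I"
      using Suc.prems(1)
      by (intro C_on_bilinear[OF bounded_bilinear_inner assms(1)])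
        (blast dest: C_on_SucD C_on_vector_derivative)+
    moreover have "C_on n (\<lambda>s. -1 :: real) I"
    proof (induction n)
      case (Suc n)
      have "C_on n (\<lambda>s. 0 :: real) I" for n
        by (induction n) auto
      then show ?case by simp
    qed simp
    ultimately show "C_on n (\<lambda>s. (?h s * (?h s * ?h s)) * ((-1) * (f s \<bullet> ?f' s))) I"
      using h by (intro mult)
  qed
qed

lemma C_on_normalize:
  fixes f :: "real \<Rightarrow> 'a::real_inner"
  assumes "open I" "C_on n f I" "\<And>s. s \<in> I \<Longrightarrow> f s \<noteq> 0"
  shows "C_on n (\<lambda>s. f s /\<^sub>R norm (f s)) I"
  using assms
  by (intro C_on_bilinear[OF bounded_bilinear_scaleR] C_on_inverse_norm)

section \<open>Moving frames\<close>

lemma bounded_bilinear_cross3: "bounded_bilinear cross3"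
  using bilinear_cross bilinear_conv_bounded_bilinear by blast

lemma cross3_orthonormal:
  assumes "norm t = 1" "norm n = 1" "t \<bullet> n = 0"
  shows "norm (cross3 t n) = 1"
    and "cross3 n (cross3 t n) = t"
    and "cross3 t (cross3 t n) = - n"
    and "cross3 (cross3 t n) n = - t"
    and "cross3 (cross3 t n) t = n"
proof -
  show "norm (cross3 t n) = 1"
    using norm_cross[of t n] assms by (simp add: power2_eq_1_iff) (smt (verit) norm_ge_zero)
  show *: "cross3 n (cross3 t n) = t" "cross3 t (cross3 t n) = - n"
    using assms Lagrange[of n t n] Lagrange[of t t n] by (simp_all add: inner_commute norm_eq_1)
  show "cross3 (cross3 t n) n = - t" "cross3 (cross3 t n) t = n"
    using * cross_skew[of "cross3 t n"] by (metis, metis add.inverse_inverse)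
qed

text \<open>
  For the unit vector \<open>b = t \<times> n\<close>, the double product \<open>b \<times> (v \<times> b)\<close> is \<open>v\<close> without its component along
  \<open>b\<close>. Expanding \<open>v \<times> (t \<times> n)\<close> first shows that it is also the sum of the two other components.
\<close>

lemma orthonormal_expansion:
  assumes "norm t = 1" "norm n = 1" "t \<bullet> n = 0"
  shows "v = (v \<bullet> t) *\<^sub>R t + (v \<bullet> n) *\<^sub>R n + (v \<bullet> cross3 t n) *\<^sub>R cross3 t n"
proof -
  let ?b = "cross3 t n"
  note c = cross3_orthonormal[OF assms]
  have "cross3 ?b (cross3 v ?b) = v - (?b \<bullet> v) *\<^sub>R ?b"
    using c(1) by (simp add: Lagrange[of ?b v ?b] norm_eq_1)
  moreover have "cross3 ?b (cross3 v ?b) = (v \<bullet> n) *\<^sub>R n + (v \<bullet> t) *\<^sub>R t"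
    by (subst Lagrange[of v t n])
      (simp add: Cross3.right_diff_distrib cross_mult_right c)
  ultimately show ?thesis
    by (simp add: inner_commute algebra_simps)
qed

text \<open>
  The Frenet equations of an orthonormal frame \<open>T\<close>, \<open>N\<close>, \<open>T \<times> N\<close>, written with the ratio
  \<open>\<sigma>\<close> of torsion to curvature because it is this ratio that the passage to the next frame
  transforms. The equation for \<open>T \<times> N\<close> is a consequence.
\<close>

definition frenet_on ::
  "real set \<Rightarrow> (real \<Rightarrow> real^3) \<Rightarrow> (real \<Rightarrow> real^3) \<Rightarrow> (real \<Rightarrow> real) \<Rightarrow> (real \<Rightarrow> real) \<Rightarrow> bool" where
  "frenet_on I T N \<kappa> \<sigma> \<longleftrightarrow>
     (\<forall>s\<in>I. norm (T s) = 1 \<and> norm (N s) = 1 \<and> T s \<bullet> N s = 0 \<and> 0 < \<kappa> s \<and>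
        (T has_vector_derivative \<kappa> s *\<^sub>R N s) (at s) \<and>
        (N has_vector_derivative \<kappa> s *\<^sub>R (\<sigma> s *\<^sub>R cross3 (T s) (N s) - T s)) (at s))"

lemma frenet_onD:
  assumes "frenet_on I T N \<kappa> \<sigma>" "s \<in> I"
  shows "norm (T s) = 1" "norm (N s) = 1" "T s \<bullet> N s = 0" "0 < \<kappa> s"
    and "(T has_vector_derivative \<kappa> s *\<^sub>R N s) (at s)"
    and "(N has_vector_derivative \<kappa> s *\<^sub>R (\<sigma> s *\<^sub>R cross3 (T s) (N s) - T s)) (at s)"
  using assms unfolding frenet_on_def by auto

lemma frenet_on_cong:
  assumes "frenet_on I T N \<kappa> \<sigma>"
    and "\<And>s. s \<in> I \<Longrightarrow> \<kappa> s = \<kappa>' s" "\<And>s. s \<in> I \<Longrightarrow> \<sigma> s = \<sigma>' s"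
  shows "frenet_on I T N \<kappa>' \<sigma>'"
  using assms unfolding frenet_on_def by metis

lemma frenet_on_binormal_derivative:
  assumes "frenet_on I T N \<kappa> \<sigma>" "s \<in> I"
  shows "((\<lambda>s. cross3 (T s) (N s)) has_vector_derivative (- (\<kappa> s * \<sigma> s)) *\<^sub>R N s) (at s)"
proof -
  note F = frenet_onD[OF assms]
  have "((\<lambda>s. cross3 (T s) (N s)) has_vector_derivative
     cross3 (T s) (\<kappa> s *\<^sub>R (\<sigma> s *\<^sub>R cross3 (T s) (N s) - T s)) + cross3 (\<kappa> s *\<^sub>R N s) (N s)) (at s)"
    by (rule bounded_bilinear.has_vector_derivative[OF bounded_bilinear_cross3 F(5,6)])
  then show ?thesis
    by (simp add: cross_mult_right cross_mult_left Cross3.right_diff_distrib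
        cross3_orthonormal[OF F(1-3)])
qed

text \<open>
  \<open>N\<close> is by definition the direction of \<open>T'\<close>, so the equation for \<open>T'\<close> is clear.
  Differentiating \<open>N \<bullet> N = 1\<close> and \<open>T \<bullet> N = 0\<close> gives the components of \<open>N'\<close> along \<open>N\<close> and \<open>T\<close>; only
  the component along \<open>T \<times> N\<close> is free.
\<close>

lemma frenet_on_unit_curve:
  assumes "open I"
    and unit: "\<And>s. s \<in> I \<Longrightarrow> norm (T s) = 1"
    and T': "\<And>s. s \<in> I \<Longrightarrow> (T has_vector_derivative T' s) (at s)"
    and nz: "\<And>s. s \<in> I \<Longrightarrow> T' s \<noteq> 0"
    and N: "\<And>s. s \<in> I \<Longrightarrow> N s = T' s /\<^sub>R norm (T' s)"
    and N': "\<And>s. s \<in> I \<Longrightarrow> (N has_vector_derivative N' s) (at s)"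
  shows "frenet_on I T N (\<lambda>s. norm (T' s)) (\<lambda>s. N' s \<bullet> cross3 (T s) (N s) / norm (T' s))"
proof -
  have inner_const: "f s \<bullet> g' + f' \<bullet> g s = 0"
    if "s \<in> I" "(f has_vector_derivative f') (at s)" "(g has_vector_derivative g') (at s)"
      "\<And>t. t \<in> I \<Longrightarrow> f t \<bullet> g t = c"
    for f g :: "real \<Rightarrow> real^3" and s f' g' c
  proof -
    have "((\<lambda>t. f t \<bullet> g t) has_vector_derivative f s \<bullet> g' + f' \<bullet> g s) (at s)"
      by (rule bounded_bilinear.has_vector_derivative[OF bounded_bilinear_inner that(2,3)])
    moreover have "((\<lambda>t. f t \<bullet> g t) has_vector_derivative 0) (at s)"
      by (rule has_vector_derivative_transform_within_open[OF has_vector_derivative_const assms(1)])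
        (use that in auto)
    ultimately show ?thesis
      using vector_derivative_unique_at by blast
  qed
  have T'N: "T' s = norm (T' s) *\<^sub>R N s" if "s \<in> I" for s
    using nz[OF that] N[OF that] by simp
  have N1: "norm (N s) = 1" if "s \<in> I" for s
    using nz[OF that] N[OF that] by simp
  have TN: "T s \<bullet> N s = 0" if "s \<in> I" for s
    using inner_const[OF that T'[OF that] T'[OF that], of 1] unit N[OF that]
    by (simp add: norm_eq_1 inner_commute)
  have "N' s = norm (T' s) *\<^sub>R
      ((N' s \<bullet> cross3 (T s) (N s) / norm (T' s)) *\<^sub>R cross3 (T s) (N s) - T s)" if "s \<in> I" for s
  proof -
    have "N' s \<bullet> N s = 0"
      using inner_const[OF that N'[OF that] N'[OF that], of 1] N1
      by (simp add: norm_eq_1 inner_commute)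
    moreover have "N' s \<bullet> T s = - norm (T' s)"
    proof -
      have "T s \<bullet> N' s + T' s \<bullet> N s = 0"
        using inner_const[OF that T'[OF that] N'[OF that]] TN by blast
      moreover have "T' s \<bullet> N s = norm (T' s)"
        by (subst T'N[OF that]) (use N1[OF that] in \<open>simp add: norm_eq_1\<close>)
      ultimately show ?thesis by (simp add: inner_commute)
    qed
    ultimately show ?thesis
      using orthonormal_expansion[OF unit[OF that] N1[OF that] TN[OF that], of "N' s"] nz[OF that]
      by (simp add: scaleR_diff_right)
  qed
  then show ?thesis
    unfolding frenet_on_def using unit N1 TN T' T'N N' nz by auto
qed

text \<open>
  This expresses \<open>\<sigma>\<close> through the two vectors and their derivatives alone, so that it inherits
  their smoothness.
\<close>

lemma frenet_on_sigma_eq: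
  assumes "frenet_on I T N \<kappa> \<sigma>" "s \<in> I"
  shows "\<sigma> s = (vector_derivative N (at s) \<bullet> cross3 (T s) (N s)) *
           inverse (norm (vector_derivative T (at s)))"
proof -
  note F = frenet_onD[OF assms]
  have "T s \<bullet> cross3 (T s) (N s) = 0" "cross3 (T s) (N s) \<bullet> cross3 (T s) (N s) = 1"
    using cross3_orthonormal(1)[OF F(1-3)] by (simp_all add: dot_cross_self norm_eq_1)
  then show ?thesis
    using F(2,4) vector_derivative_at[OF F(5)] vector_derivative_at[OF F(6)]
    by (simp add: inner_diff_left)
qed

lemma frenet_on_sigma_differentiable:
  assumes "open I" "frenet_on I T N \<kappa> \<sigma>" "C_on 2 T I" "C_on 2 N I" "s \<in> I"
  shows "(\<sigma> has_real_derivative deriv \<sigma> s) (at s)"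
proof -
  have nz: "vector_derivative T (at s) \<noteq> 0" if "s \<in> I" for s
    using frenet_onD[OF assms(2) that] vector_derivative_at by fastforce
  have T: "C_on 1 T I" "C_on 1 (\<lambda>s. vector_derivative T (at s)) I"
    and N: "C_on 1 N I" "C_on 1 (\<lambda>s. vector_derivative N (at s)) I"
    using assms(3,4) C_on_SucD C_on_vector_derivative unfolding Suc_1[symmetric] by blast+
  have "C_on 1 (\<lambda>s. (vector_derivative N (at s) \<bullet> cross3 (T s) (N s)) *
           inverse (norm (vector_derivative T (at s)))) I"
    using T N nz
    by (intro C_on_bilinear[OF bounded_bilinear_mult] C_on_inverse_norm
        C_on_bilinear[OF bounded_bilinear_inner] C_on_bilinear[OF bounded_bilinear_cross3] assms(1))
  then have "C_on 1 \<sigma> I"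
    by (rule C_on_cong[OF assms(1), rotated]) (simp add: frenet_on_sigma_eq[OF assms(2)])
  then have "(\<sigma> has_real_derivative vector_derivative \<sigma> (at s)) (at s)"
    using C_on_SucE[of 0 \<sigma> I s] assms(5)
    by (simp add: has_real_derivative_iff_has_vector_derivative)
  then show ?thesis
    using DERIV_imp_deriv by force
qed

text \<open>
  Put \<open>w = sqrt (1 + \<sigma>\<^sup>2)\<close> and \<open>B = T \<times> N\<close>. Since \<open>N' = \<kappa> (\<sigma> B - T)\<close> has length \<open>\<kappa> w\<close>, the next
  frame is \<open>N\<close>, \<open>(\<sigma> B - T) / w\<close> and \<open>(B + \<sigma> T) / w\<close>: it consists of \<open>N\<close> and
  of \<open>-T\<close> and \<open>B\<close> turned about \<open>N\<close> by an angle with tangent \<open>\<sigma>\<close>. Its torsion is the rate \<open>\<sigma>' / w\<^sup>2\<close> at which this angle changes, which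
  divided by the curvature \<open>\<kappa> w\<close> gives the next \<open>\<sigma>\<close>.
\<close>

lemma frenet_on_next:
  assumes "open I" "frenet_on I T N \<kappa> \<sigma>"
    and \<sigma>': "\<And>s. s \<in> I \<Longrightarrow> (\<sigma> has_real_derivative \<sigma>' s) (at s)"
    and M: "\<And>s. s \<in> I \<Longrightarrow> M s = vector_derivative N (at s) /\<^sub>R norm (vector_derivative N (at s))"
  shows "frenet_on I N M (\<lambda>s. \<kappa> s * sqrt (1 + (\<sigma> s)\<^sup>2))
           (\<lambda>s. \<sigma>' s / (\<kappa> s * (1 + (\<sigma> s)\<^sup>2) powr (3/2)))"
proof -
  define w where "w s = sqrt (1 + (\<sigma> s)\<^sup>2)" for s
  define B where "B s = cross3 (T s) (N s)" for s
  have w: "w s > 0" "(w s)\<^sup>2 = 1 + (\<sigma> s)\<^sup>2" for s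
    unfolding w_def by (auto intro: add_pos_nonneg)
  have w3: "(1 + (\<sigma> s)\<^sup>2) powr (3/2) = w s ^ 3" for s
  proof -
    have "(1 + (\<sigma> s)\<^sup>2) powr (3/2) = ((w s)\<^sup>2) powr (3/2)" by (simp add: w)
    also have "\<dots> = (w s powr 2) powr (3/2)" using w(1)[of s] by simp
    also have "\<dots> = w s powr 3" by (simp add: powr_powr)
    also have "\<dots> = w s ^ 3" using w(1)[of s] by simp
    finally show ?thesis .
  qed
  have *: "norm (N s) = 1 \<and> norm (M s) = 1 \<and> N s \<bullet> M s = 0 \<and> 0 < \<kappa> s * w s \<and>
        (N has_vector_derivative (\<kappa> s * w s) *\<^sub>R M s) (at s) \<and>
        (M has_vector_derivative (\<kappa> s * w s) *\<^sub>R
            ((\<sigma>' s / (\<kappa> s * w s ^ 3)) *\<^sub>R cross3 (N s) (M s) - N s)) (at s)"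
    if s: "s \<in> I" for s
  proof -
    note F = frenet_onD[OF assms(2) s]
    have orth: "B s \<bullet> B s = 1" "T s \<bullet> T s = 1" "B s \<bullet> T s = 0" "T s \<bullet> B s = 0" "N s \<bullet> B s = 0"
      "N s \<bullet> T s = 0"
      using F(1-3) cross3_orthonormal(1)[OF F(1-3)]
      by (simp_all add: B_def dot_cross_self norm_eq_1 inner_commute)
    have M_eq: "M t = (1 / w t) *\<^sub>R (\<sigma> t *\<^sub>R B t - T t)" if t: "t \<in> I" for t
    proof -
      note F = frenet_onD[OF assms(2) t]
      have o: "B t \<bullet> B t = 1" "T t \<bullet> T t = 1" "B t \<bullet> T t = 0" "T t \<bullet> B t = 0"
        using F(1) cross3_orthonormal(1)[OF F(1-3)]
        by (simp_all add: B_def dot_cross_self norm_eq_1)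
      have "norm (\<sigma> t *\<^sub>R B t - T t) = w t"
        unfolding w_def norm_eq_sqrt_inner
        by (simp add: inner_diff_left inner_diff_right o power2_eq_square algebra_simps)
      moreover have "vector_derivative N (at t) = \<kappa> t *\<^sub>R (\<sigma> t *\<^sub>R B t - T t)"
        using F(6) vector_derivative_at unfolding B_def by blast
      ultimately show ?thesis
        using M[OF t] F(4) w(1)[of t] by (simp add: divide_inverse)
    qed
    have normM: "norm (M s) = 1"
    proof -
      have "norm (\<sigma> s *\<^sub>R B s - T s) = w s"
        unfolding w_def norm_eq_sqrt_inner
        by (simp add: inner_diff_left inner_diff_right orth power2_eq_square algebra_simps)
      then show ?thesis
        using M_eq[OF s] w(1)[of s] by simp
    qed
    have NM: "N s \<bullet> M s = 0"
      by (simp add: M_eq[OF s] inner_diff_right orth)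
    have cross: "cross3 (N s) (M s) = (1 / w s) *\<^sub>R (\<sigma> s *\<^sub>R T s + B s)"
    proof -
      have "cross3 (N s) (B s) = T s" "cross3 (N s) (T s) = - B s"
        unfolding B_def using cross3_orthonormal(2)[OF F(1-3)] cross_skew by blast+
      then show ?thesis
        by (simp add: M_eq[OF s] cross_mult_right Cross3.right_diff_distrib)
    qed
    have N': "(N has_vector_derivative (\<kappa> s * w s) *\<^sub>R M s) (at s)"
      using F(6) w(1)[of s] by (simp add: M_eq[OF s] B_def)
    have w': "((\<lambda>t. 1 / w t) has_real_derivative - (\<sigma> s * \<sigma>' s) / w s ^ 3) (at s)"
    proof -
      have pos: "0 < 1 + (\<sigma> s)\<^sup>2" by (auto intro: add_pos_nonneg)
      have "(w has_real_derivative \<sigma> s * \<sigma>' s / w s) (at s)"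
        unfolding w_def using pos
        by (auto intro!: derivative_eq_intros \<sigma>'[OF s] simp: field_simps)
      then show ?thesis
        using w(1)[of s]
        by (auto intro!: derivative_eq_intros simp: field_simps power3_eq_cube)
    qed
    have B': "(B has_vector_derivative (- (\<kappa> s * \<sigma> s)) *\<^sub>R N s) (at s)"
      unfolding B_def by (rule frenet_on_binormal_derivative[OF assms(2) s])
    define p q where "p = 1 / w s" and "q = \<sigma> s * \<sigma>' s / w s ^ 3"
    have "((\<lambda>t. (1 / w t) *\<^sub>R (\<sigma> t *\<^sub>R B t - T t)) has_vector_derivative
        p *\<^sub>R ((\<sigma> s *\<^sub>R (- (\<kappa> s * \<sigma> s)) *\<^sub>R N s + \<sigma>' s *\<^sub>R B s) - \<kappa> s *\<^sub>R N s) +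
        (- q) *\<^sub>R (\<sigma> s *\<^sub>R B s - T s)) (at s)"
      unfolding p_def q_def minus_divide_left
      by (intro has_vector_derivative_scaleR w' has_vector_derivative_diff \<sigma>'[OF s] B' F(5))
    also have "p *\<^sub>R ((\<sigma> s *\<^sub>R (- (\<kappa> s * \<sigma> s)) *\<^sub>R N s + \<sigma>' s *\<^sub>R B s) - \<kappa> s *\<^sub>R N s) +
        (- q) *\<^sub>R (\<sigma> s *\<^sub>R B s - T s) =
        (- (\<kappa> s * ((1 + (\<sigma> s)\<^sup>2) * p))) *\<^sub>R N s + (p * \<sigma>' s - q * \<sigma> s) *\<^sub>R B s + q *\<^sub>R T s"
      by (simp add: algebra_simps power2_eq_square)
    also have "(1 + (\<sigma> s)\<^sup>2) * p = w s"
      unfolding w(2)[symmetric] p_def using w(1)[of s] by (simp add: power2_eq_square)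
    also have "p * \<sigma>' s - q * \<sigma> s = \<sigma>' s / w s ^ 3"
    proof -
      have "p * \<sigma>' s - q * \<sigma> s = ((w s)\<^sup>2 - (\<sigma> s)\<^sup>2) * (\<sigma>' s / w s ^ 3)"
        using w(1)[of s]
        by (simp add: p_def q_def divide_simps) (simp add: algebra_simps power2_eq_square power3_eq_cube)
      then show ?thesis
        by (simp add: w(2))
    qed
    also have "(- (\<kappa> s * w s)) *\<^sub>R N s + (\<sigma>' s / w s ^ 3) *\<^sub>R B s + q *\<^sub>R T s =
        (\<kappa> s * w s) *\<^sub>R ((\<sigma>' s / (\<kappa> s * w s ^ 3)) *\<^sub>R cross3 (N s) (M s) - N s)"
    proof -
      define a where "a = \<sigma>' s / (\<kappa> s * w s ^ 3) * (1 / w s)"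
      have a: "\<sigma>' s / w s ^ 3 = \<kappa> s * w s * a" "q = \<kappa> s * w s * a * \<sigma> s"
        unfolding a_def q_def using F(4) w(1)[of s] by simp_all
      show ?thesis
        unfolding cross scaleR_scaleR[of _ "1 / w s"] a_def[symmetric] a
        by (simp add: scaleR_diff_right scaleR_add_right)
    qed
    finally have "(M has_vector_derivative (\<kappa> s * w s) *\<^sub>R
            ((\<sigma>' s / (\<kappa> s * w s ^ 3)) *\<^sub>R cross3 (N s) (M s) - N s)) (at s)"
      by (rule has_vector_derivative_transform_within_open[OF _ assms(1) s]) (simp add: M_eq)
    then show ?thesis
      using F(2,4) w(1)[of s] normM NM N' by simp
  qed
  show ?thesis
    unfolding frenet_on_def w3 w_def[symmetric] using * by blast
qed

section \<open>Constant angle with a fixed direction\<close>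

text \<open>
  If \<open>\<sigma> = cot \<phi>\<close>, the Frenet equations say exactly that \<open>cos \<phi> T + sin \<phi> B\<close> does not move.
\<close>

lemma frenet_on_axis_exists:
  assumes "open I" "is_interval I" "I \<noteq> {}" "frenet_on I T N \<kappa> \<sigma>"
    and \<phi>: "0 < \<phi>" "\<phi> < pi" "\<And>s. s \<in> I \<Longrightarrow> \<sigma> s = cot \<phi>"
  obtains d where "norm d = 1" "\<And>s. s \<in> I \<Longrightarrow> T s \<bullet> d = cos \<phi>"
proof -
  define D where "D s = cos \<phi> *\<^sub>R T s + sin \<phi> *\<^sub>R cross3 (T s) (N s)" for s
  have "(D has_vector_derivative 0) (at s)" if "s \<in> I" for s
  proof -
    have "(D has_vector_derivative
        cos \<phi> *\<^sub>R \<kappa> s *\<^sub>R N s + sin \<phi> *\<^sub>R (- (\<kappa> s * \<sigma> s)) *\<^sub>R N s) (at s)"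
      unfolding D_def
      using frenet_onD(5)[OF assms(4) that] frenet_on_binormal_derivative[OF assms(4) that]
      by (intro has_vector_derivative_add
          bounded_linear.has_vector_derivative[OF bounded_linear_scaleR_right])
    moreover have "sin \<phi> * (\<kappa> s * \<sigma> s) = cos \<phi> * \<kappa> s"
      using \<phi>(3)[OF that] sin_gt_zero[OF \<phi>(1,2)] by (simp add: cot_def)
    ultimately show ?thesis
      by simp
  qed
  then obtain d where d: "\<And>s. s \<in> I \<Longrightarrow> D s = d"
    using has_vector_derivative_zero_constant[of I D] assms(2) is_interval_convex
      has_vector_derivative_at_within by metis
  have Td: "T s \<bullet> d = cos \<phi>" if "s \<in> I" for s
    unfolding d[OF that, symmetric] D_def using frenet_onD(1)[OF assms(4) that]
    by (simp add: inner_add_right dot_cross_self norm_eq_1)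
  obtain s where s: "s \<in> I" using assms(3) by blast
  note F = frenet_onD[OF assms(4) s]
  have "D s \<bullet> D s = (cos \<phi>)\<^sup>2 + (sin \<phi>)\<^sup>2"
    using F(1) cross3_orthonormal(1)[OF F(1-3)]
    by (simp add: D_def inner_add_left inner_add_right dot_cross_self norm_eq_1 power2_eq_square)
  then have "norm d = 1"
    using d[OF s] by (simp add: norm_eq_1)
  with Td that show thesis by blast
qed

text \<open>
  If \<open>T \<bullet> d\<close> is constant, its derivative \<open>\<kappa> (N \<bullet> d)\<close> vanishes, and so does that of \<open>N \<bullet> d\<close>. Thus the
  fixed vector \<open>d\<close> stays in the plane of \<open>T\<close> and \<open>B\<close>, where it has constant components, and
  \<open>\<sigma>\<close> is their ratio.
\<close>

lemma frenet_on_axis_components: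
  assumes "open I" "is_interval I" "I \<noteq> {}" "frenet_on I T N \<kappa> \<sigma>"
    and "norm d = 1" and c: "\<And>s. s \<in> I \<Longrightarrow> T s \<bullet> d = c"
  obtains b where "c\<^sup>2 + b\<^sup>2 = 1" "\<And>s. s \<in> I \<Longrightarrow> \<sigma> s * b = c"
proof -
  have inner_d: "((\<lambda>t. f t \<bullet> d) has_vector_derivative f' \<bullet> d) (at s)"
    if "(f has_vector_derivative f') (at s)" for f :: "real \<Rightarrow> real^3" and f' s
    using that by (rule bounded_linear.has_vector_derivative[OF bounded_linear_inner_left])
  have const: "f' \<bullet> d = 0"
    if "(f has_vector_derivative f') (at s)" "s \<in> I" "\<And>t. t \<in> I \<Longrightarrow> f t \<bullet> d = a"
    for f :: "real \<Rightarrow> real^3" and f' s a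
  proof -
    have "((\<lambda>t. f t \<bullet> d) has_vector_derivative 0) (at s)"
      by (rule has_vector_derivative_transform_within_open[OF has_vector_derivative_const assms(1)])
        (use that in auto)
    then show ?thesis
      using inner_d[OF that(1)] vector_derivative_unique_at by blast
  qed
  have Nd: "N s \<bullet> d = 0" if "s \<in> I" for s
    using const[OF frenet_onD(5)[OF assms(4) that] that c] frenet_onD(4)[OF assms(4) that] by simp
  have ratio: "\<sigma> s * (cross3 (T s) (N s) \<bullet> d) = c" if "s \<in> I" for s
    using const[OF frenet_onD(6)[OF assms(4) that] that Nd] frenet_onD(4)[OF assms(4) that] c[OF that]
    by (simp add: inner_diff_left)
  have "((\<lambda>s. cross3 (T s) (N s) \<bullet> d) has_vector_derivative 0) (at s within I)" if "s \<in> I" for s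
    using inner_d[OF frenet_on_binormal_derivative[OF assms(4) that]] Nd[OF that]
    by (simp add: has_vector_derivative_at_within)
  then obtain b where b: "\<And>s. s \<in> I \<Longrightarrow> cross3 (T s) (N s) \<bullet> d = b"
    using has_vector_derivative_zero_constant[OF is_interval_convex[OF assms(2)]] by blast
  obtain s where s: "s \<in> I" using assms(3) by blast
  note F = frenet_onD[OF assms(4) s]
  have "d = c *\<^sub>R T s + b *\<^sub>R cross3 (T s) (N s)"
    using orthonormal_expansion[OF F(1-3), of d] Nd[OF s] b[OF s] c[OF s]
    by (simp add: inner_commute)
  then have "d \<bullet> d = c * (T s \<bullet> d) + b * (cross3 (T s) (N s) \<bullet> d)"
    by (metis inner_add_left inner_scaleR_left)
  then have "c\<^sup>2 + b\<^sup>2 = 1"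
    using assms(5) b[OF s] c[OF s] by (simp add: norm_eq_1 power2_eq_square)
  then show thesis
    using that ratio b by blast
qed

lemma cot_surj:
  obtains \<phi> where "0 < \<phi>" "\<phi> < pi" "cot \<phi> = (x::real)"
proof
  show "0 < pi / 2 - arctan x" "pi / 2 - arctan x < pi"
    using arctan_bounded[of x] by linarith+
  show "cot (pi / 2 - arctan x) = x"
    by (simp flip: tan_cot' add: tan_arctan)
qed

text \<open>
  With \<open>c\<close> and \<open>b\<close> the components of the axis, \<open>(c, b)\<close> is a point of the unit circle on the line
  through \<open>(cos \<phi>, sin \<phi>)\<close>, and reversing the axis exchanges the two such points.
\<close>

lemma unit_circle_cot:
  fixes b c \<phi> :: real
  assumes "0 < \<phi>" "\<phi> < pi" "c\<^sup>2 + b\<^sup>2 = 1" "cot \<phi> * b = c"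
  shows "c = cos \<phi> \<or> c = - cos \<phi>"
proof -
  have s: "sin \<phi> > 0" using assms(1,2) by (rule sin_gt_zero)
  then have cs: "cos \<phi> * b = c * sin \<phi>"
    using assms(4) by (simp add: cot_def field_simps)
  have "c\<^sup>2 = c\<^sup>2 * (sin \<phi>)\<^sup>2 + c\<^sup>2 * (cos \<phi>)\<^sup>2"
    by (simp flip: distrib_left)
  also have "\<dots> = (cos \<phi> * b)\<^sup>2 + c\<^sup>2 * (cos \<phi>)\<^sup>2"
    unfolding cs by (simp add: power_mult_distrib)
  also have "\<dots> = (cos \<phi>)\<^sup>2 * (c\<^sup>2 + b\<^sup>2)"
    by (simp add: power_mult_distrib algebra_simps)
  finally show ?thesis
    using assms(3) by (simp add: power2_eq_iff)
qed

section \<open>The iterated tangents\<close>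

text \<open>
  Unit speed makes the first normalization trivial, so the iterated tangents of index 1 and 2 agree
  with \<open>tangent\<close> and \<open>principal_normal\<close>, but only on \<open>I\<close>. Openness of \<open>I\<close> carries this agreement
  over to derivatives.
\<close>

lemma iter_tangent_frenet_base:
  assumes "open I" "C_on (m + 3) \<psi> I" "unit_speed_on \<psi> I" "\<forall>s\<in>I. curvature \<psi> s \<noteq> 0"
  shows "C_on (m + 2) (iter_tangent \<psi> 1) I"
    and "frenet_on I (iter_tangent \<psi> 1) (iter_tangent \<psi> 2) (curvature \<psi>) (slant_sigma \<psi> 0)"
proof -
  let ?T = "iter_tangent \<psi> 1" and ?N = "iter_tangent \<psi> 2"
  let ?T' = "\<lambda>s. vector_derivative ?T (at s)" and ?N' = "\<lambda>s. vector_derivative ?N (at s)"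
  have T: "?T s = tangent \<psi> s" if "s \<in> I" for s
    using assms(3) that by (simp add: unit_speed_on_def tangent_def)
  have T': "?T' s = vector_derivative (tangent \<psi>) (at s)" if "s \<in> I" for s
    by (rule vector_derivative_cong_open[OF assms(1) that T])
  have N: "?N s = ?T' s /\<^sub>R norm (?T' s)" for s
    by (simp add: numeral_2_eq_2)
  have Np: "?N s = principal_normal \<psi> s" if "s \<in> I" for s
    unfolding N T'[OF that] principal_normal_def curvature_def ..
  have N': "?N' s = vector_derivative (principal_normal \<psi>) (at s)" if "s \<in> I" for s
    by (rule vector_derivative_cong_open[OF assms(1) that Np])
  have nz: "?T' s \<noteq> 0" if "s \<in> I" for s
    using assms(4) that unfolding T'[OF that] curvature_def by auto
  have "C_on (m + 2) (tangent \<psi>) I"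
    using assms(2) unfolding tangent_def [abs_def] by (simp add: numeral_eq_Suc)
  then show C: "C_on (m + 2) ?T I"
    by (rule C_on_cong[OF assms(1), rotated]) (simp only: T)
  have "C_on (m + 1) (\<lambda>s. ?T' s /\<^sub>R norm (?T' s)) I"
    by (rule C_on_normalize[OF assms(1)]) (use C nz in auto)
  then have "C_on (Suc m) ?N I"
    unfolding N[symmetric] by simp
  then have dN: "(?N has_vector_derivative ?N' s) (at s)" if "s \<in> I" for s
    using C_on_SucE that by blast
  have "C_on (Suc (Suc m)) ?T I"
    using C by (simp only: add_2_eq_Suc')
  then have dT: "(?T has_vector_derivative ?T' s) (at s)" if "s \<in> I" for s
    using C_on_SucE that by blast
  have "norm (?T s) = 1" if "s \<in> I" for s
    using T[OF that] assms(3) that by (simp only: unit_speed_on_def tangent_def)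
  from frenet_on_unit_curve[OF assms(1) this dT nz N dN]
  have "frenet_on I ?T ?N (\<lambda>s. norm (?T' s)) (\<lambda>s. ?N' s \<bullet> cross3 (?T s) (?N s) / norm (?T' s))"
    by blast
  moreover have "norm (?T' s) = curvature \<psi> s"
    and "?N' s \<bullet> cross3 (?T s) (?N s) / norm (?T' s) = slant_sigma \<psi> 0 s" if "s \<in> I" for s
    using that by (simp_all only: T T' N' Np curvature_def torsion_def binormal_def slant_sigma.simps)
  ultimately show "frenet_on I ?T ?N (curvature \<psi>) (slant_sigma \<psi> 0)"
    by (rule frenet_on_cong)
qed

text \<open>
  The recursion for \<open>slant_sigma\<close> is the passage from one frame to the next, the product of square
  roots being the accumulated change of the curvature. Each passage uses up one derivative, so a
  curve of class \<open>j + m + 3\<close> keeps \<open>m + 2\<close> derivatives of its iterated tangent of index \<open>j + 1\<close>.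
\<close>

lemma iter_tangent_frenet:
  assumes "open I" "C_on (j + m + 3) \<psi> I" "unit_speed_on \<psi> I" "\<forall>s\<in>I. curvature \<psi> s \<noteq> 0"
  shows "C_on (m + 2) (iter_tangent \<psi> (Suc j)) I \<and>
     frenet_on I (iter_tangent \<psi> (Suc j)) (iter_tangent \<psi> (Suc (Suc j)))
       (\<lambda>s. curvature \<psi> s * (\<Prod>i<j. sqrt (1 + (slant_sigma \<psi> i s)\<^sup>2))) (slant_sigma \<psi> j)"
  using assms(2)
proof (induction j arbitrary: m)
  case 0
  then show ?case
    using iter_tangent_frenet_base[OF assms(1) _ assms(3,4), of m]
    by (simp only: numeral_2_eq_2 One_nat_def add_0 lessThan_0 prod.empty mult_1_right)
next
  case (Suc j)
  let ?T = "iter_tangent \<psi> (Suc j)" and ?N = "iter_tangent \<psi> (Suc (Suc j))"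
  let ?\<kappa> = "\<lambda>s. curvature \<psi> s * (\<Prod>i<j. sqrt (1 + (slant_sigma \<psi> i s)\<^sup>2))"
  let ?T' = "\<lambda>s. vector_derivative ?T (at s)"
  have C: "C_on (Suc m + 2) ?T I" and F: "frenet_on I ?T ?N ?\<kappa> (slant_sigma \<psi> j)"
    using Suc.IH[of "Suc m"] Suc.prems by (simp_all only: add_Suc_right add_Suc)
  have nz: "?T' s \<noteq> 0" if "s \<in> I" for s
    using frenet_onD[OF F that] vector_derivative_at by fastforce
  have "C_on (m + 2) (\<lambda>s. ?T' s /\<^sub>R norm (?T' s)) I"
    by (rule C_on_normalize[OF assms(1) _ nz]) (use C in \<open>simp only: add_Suc C_on.simps\<close>)
  then have CN: "C_on (m + 2) ?N I"
    by (simp only: iter_tangent.simps)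
  have "C_on 2 ?T I" "C_on 2 ?N I"
    using C_on_antimono[OF _ C, of 2] C_on_antimono[OF _ CN, of 2] by simp_all
  note \<sigma>' = frenet_on_sigma_differentiable[OF assms(1) F this]
  have "frenet_on I ?N (iter_tangent \<psi> (Suc (Suc (Suc j))))
      (\<lambda>s. ?\<kappa> s * sqrt (1 + (slant_sigma \<psi> j s)\<^sup>2))
      (\<lambda>s. deriv (slant_sigma \<psi> j) s / (?\<kappa> s * (1 + (slant_sigma \<psi> j s)\<^sup>2) powr (3/2)))"
    by (rule frenet_on_next[OF assms(1) F \<sigma>'])
      (simp_all only: iter_tangent.simps(2)[of \<psi> "Suc (Suc j)"])
  with CN show ?case
    by (simp only: slant_sigma.simps prod.lessThan_Suc mult.assoc)
qed

theorem lemma5p3: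
  fixes k :: nat and \<psi> :: "real \<Rightarrow> real^3" and I :: "real set"
  assumes "open I" and "is_interval I" and "I \<noteq> {}"
    and "C_on (k + 3) \<psi> I"
    and "unit_speed_on \<psi> I"
    and "\<forall>s\<in>I. curvature \<psi> s \<noteq> 0"
    and "\<forall>s\<in>I. torsion \<psi> s \<noteq> 0"
  shows "(slant_helix k \<psi> I \<longleftrightarrow>
           (\<exists>\<phi>. 0 < \<phi> \<and> \<phi> < pi \<and> (\<forall>s\<in>I. slant_sigma \<psi> k s = cot \<phi>)))
       \<and> (\<forall>\<phi>. 0 < \<phi> \<and> \<phi> < pi \<and> (\<forall>s\<in>I. slant_sigma \<psi> k s = cot \<phi>) \<longrightarrow>
           (\<exists>d. norm d = 1 \<and> (\<forall>s\<in>I. vec_angle (iter_tangent \<psi> (k + 1) s) d = \<phi>))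
         \<and> (\<forall>d. slant_axis k \<psi> I d \<longrightarrow>
              (\<exists>e\<in>{d, - d}. \<forall>s\<in>I. vec_angle (iter_tangent \<psi> (k + 1) s) e = \<phi>)))"
proof -
  let ?T = "iter_tangent \<psi> (k + 1)" and ?\<sigma> = "slant_sigma \<psi> k"
  obtain N \<kappa> where F: "frenet_on I ?T N \<kappa> ?\<sigma>"
    using iter_tangent_frenet[of I k 0 \<psi>] assms(1,4-6) by auto
  have angle: "vec_angle (?T s) e = \<phi>"
    if "s \<in> I" "norm e = 1" "?T s \<bullet> e = cos \<phi>" "0 < \<phi>" "\<phi> < pi" for s e \<phi>
    using that frenet_onD(1)[OF F that(1)] unfolding vec_angle_def by (simp add: arccos_cos)
  have axis: "\<exists>d. norm d = 1 \<and> (\<forall>s\<in>I. ?T s \<bullet> d = cos \<phi>)"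
    if "0 < \<phi>" "\<phi> < pi" "\<forall>s\<in>I. ?\<sigma> s = cot \<phi>" for \<phi>
    using frenet_on_axis_exists[OF assms(1-3) F that(1,2)] that(3) by metis
  have "\<exists>\<phi>. 0 < \<phi> \<and> \<phi> < pi \<and> (\<forall>s\<in>I. ?\<sigma> s = cot \<phi>)" if "slant_axis k \<psi> I d" for d
  proof -
    obtain c where d: "norm d = 1" "\<And>s. s \<in> I \<Longrightarrow> ?T s \<bullet> d = c"
      using \<open>slant_axis k \<psi> I d\<close> unfolding slant_axis_def by blast
    obtain b where b: "c\<^sup>2 + b\<^sup>2 = 1" "\<And>s. s \<in> I \<Longrightarrow> ?\<sigma> s * b = c"
      using frenet_on_axis_components[OF assms(1-3) F d] by blast
    \<comment> \<open>\<open>b = 0\<close> would force \<open>c = 0\<close>, against \<open>c\<^sup>2 + b\<^sup>2 = 1\<close>.\<close>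
    have "b \<noteq> 0" using b assms(3) by force
    obtain \<phi> where "0 < \<phi>" "\<phi> < pi" "cot \<phi> = c / b"
      by (rule cot_surj)
    then show ?thesis
      using b(2) \<open>b \<noteq> 0\<close> by (metis nonzero_mult_div_cancel_right)
  qed
  moreover have "slant_helix k \<psi> I" if "0 < \<phi>" "\<phi> < pi" "\<forall>s\<in>I. ?\<sigma> s = cot \<phi>" for \<phi>
    using axis[OF that] unfolding slant_helix_def slant_axis_def by blast
  moreover have "\<exists>d. norm d = 1 \<and> (\<forall>s\<in>I. vec_angle (?T s) d = \<phi>)"
    if "0 < \<phi>" "\<phi> < pi" "\<forall>s\<in>I. ?\<sigma> s = cot \<phi>" for \<phi>
    using axis[OF that] angle that by blast
  moreover have "\<exists>e\<in>{d, - d}. \<forall>s\<in>I. vec_angle (?T s) e = \<phi>"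
    if \<phi>: "0 < \<phi>" "\<phi> < pi" "\<forall>s\<in>I. ?\<sigma> s = cot \<phi>" and "slant_axis k \<psi> I d" for \<phi> d
  proof -
    obtain c where d: "norm d = 1" "\<And>s. s \<in> I \<Longrightarrow> ?T s \<bullet> d = c"
      using \<open>slant_axis k \<psi> I d\<close> unfolding slant_axis_def by blast
    obtain b where b: "c\<^sup>2 + b\<^sup>2 = 1" "\<And>s. s \<in> I \<Longrightarrow> ?\<sigma> s * b = c"
      using frenet_on_axis_components[OF assms(1-3) F d] by blast
    have "cot \<phi> * b = c"
      using assms(3) b(2) \<phi>(3) by force
    then consider "c = cos \<phi>" | "c = - cos \<phi>"
      using unit_circle_cot[OF \<phi>(1,2) b(1)] by blast
    then show ?thesis
    proof cases
      case 1
      then show ?thesis using angle[OF _ d(1)] d(2) \<phi> by simp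
    next
      case 2
      then show ?thesis using angle[of _ "- d" \<phi>] d \<phi> by simp
    qed
  qed
  ultimately show ?thesis
    unfolding slant_helix_def by blast
qed

end
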